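(* When both models have $\xi_i$ of the same sign, a provider-optimal policy $(i^*,s^* )$ is given as follows. 1. If $\xi_1,\xi_2>0$, then $$(i^*,s^* )=\begin{cases}(1,0) & \text{if } \frac{c_1}{p_1}\le\frac{c_2}{p_2},\\ (2,0) & \text{otherwise.}\end{cases}$$ 2. If $\xi_1,\xi_2<0$, then $$(i^*,s^* )=\begin{cases}(1,s)\ \text{for any } s\in[0,1] & \text{if } P\le\frac{c_2-c_1}{p_2-p_1},\\ (2,0) & \text{otherwise.}\end{cases}$$
   Context: Two models $M_1,M_2$ have success probabilities $0<p_1<p_2<1$, user latencies $t_1<t_2$ in $[0,1]$, and provider costs $c_1<c_2$ in $[0,1]$. A success is worth $V>0$ to the user, abandonment costs the provider a penalty $P>0$, and $\xi_i:=Vp_i-t_i$ for $i\in\{1,2\}$. A provider policy is a pair $(i,s)$ with $i\in\{1,2\}$ the initial model and $s\in[0,1]$ the probability of cascading from $M_1$ to $M_2$ after a failure of $M_1$ (if $i=2$ the value of $s$ is irrelevant and the policy is written $(2,0)$). The user chooses an abandonment probability $q\in[0,1]$. Let $\alpha(q):=(1-p_1)(1-q)$, $\beta(q):=\frac{1}{p_2+(1-p_2)q}$, and $$S_1(s,q)=\tfrac{p_1+\alpha(q)\beta(q)p_2 s}{1-\alpha(q)(1-s)},\quad L_1(s,q)=\tfrac{t_1+\alpha(q)\beta(q)t_2 s}{1-\alpha(q)(1-s)},\quad C_1(s,q)=\tfrac{c_1+\alpha(q)\beta(q)c_2 s}{1-\alpha(q)(1-s)},$$ $$S_2(s,q)=\beta(q)p_2,\quad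 L_2(s,q)=\beta(q)t_2,\quad C_2(s,q)=\beta(q)c_2$$ (success probability, expected latency, expected service cost). User utility: $U_i(s,q):=VS_i(s,q)-L_i(s,q)$. Provider cost: $J_i(s,q):=C_i(s,q)+P(1-S_i(s,q))$. The user best response is $q^*(i,s)\in\arg\max_{q\in[0,1]}U_i(s,q)$. A policy $(i^*,s^* )$ is provider-optimal if it minimizes $J_i(s,q^*(i,s))$ over all $(i,s)\in\{1,2\}\times[0,1]$. *)

theory Defs
  imports Complex_Main
begin

datatype model = M1 | M2

definition alpha :: "(model \<Rightarrow> real) \<Rightarrow> real \<Rightarrow> real" where
  "alpha p q = (1 - p M1) * (1 - q)"

definition beta :: "(model \<Rightarrow> real) \<Rightarrow> real \<Rightarrow> real" where
  "beta p q = 1 / (p M2 + (1 - p M2) * q)"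

text \<open>
  Model parameters are functions of the model: success probabilities \<open>p\<close>, user latencies \<open>t\<close>,
  provider costs \<open>c\<close>. In the functions below, \<open>s\<close> is the probability of cascading from \<open>M1\<close> to \<open>M2\<close>
  after a failure of \<open>M1\<close> (irrelevant when starting with \<open>M2\<close>), and \<open>q\<close> is the user's
  abandonment probability.
\<close>

fun success :: "(model \<Rightarrow> real) \<Rightarrow> model \<Rightarrow> real \<Rightarrow> real \<Rightarrow> real" where
  "success p M1 s q =
     (p M1 + alpha p q * beta p q * p M2 * s) / (1 - alpha p q * (1 - s))"
| "success p M2 s q = beta p q * p M2"

fun latency :: "(model \<Rightarrow> real) \<Rightarrow> (model \<Rightarrow> real) \<Rightarrow> model \<Rightarrow> real \<Rightarrow> real \<Rightarrow> real" where
  "latency p t M1 s q =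
     (t M1 + alpha p q * beta p q * t M2 * s) / (1 - alpha p q * (1 - s))"
| "latency p t M2 s q = beta p q * t M2"

fun service_cost :: "(model \<Rightarrow> real) \<Rightarrow> (model \<Rightarrow> real) \<Rightarrow> model \<Rightarrow> real \<Rightarrow> real \<Rightarrow> real" where
  "service_cost p c M1 s q =
     (c M1 + alpha p q * beta p q * c M2 * s) / (1 - alpha p q * (1 - s))"
| "service_cost p c M2 s q = beta p q * c M2"

definition user_utility ::
  "(model \<Rightarrow> real) \<Rightarrow> (model \<Rightarrow> real) \<Rightarrow> real \<Rightarrow> model \<Rightarrow> real \<Rightarrow> real \<Rightarrow> real" where
  "user_utility p t V i s q = V * success p i s q - latency p t i s q"

definition provider_cost ::
  "(model \<Rightarrow> real) \<Rightarrow> (model \<Rightarrow> real) \<Rightarrow> real \<Rightarrow> model \<Rightarrow> real \<Rightarrow> real \<Rightarrow> real" where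
  "provider_cost p c P i s q = service_cost p c i s q + P * (1 - success p i s q)"

definition xi :: "(model \<Rightarrow> real) \<Rightarrow> (model \<Rightarrow> real) \<Rightarrow> real \<Rightarrow> model \<Rightarrow> real" where
  "xi p t V i = V * p i - t i"

text \<open>
  \<open>qstar\<close> is an arbitrary selection from the user's sets of optimal abandonment probabilities,
  one for each policy; no tie-breaking rule is imposed.
\<close>

definition best_response ::
  "(model \<Rightarrow> real) \<Rightarrow> (model \<Rightarrow> real) \<Rightarrow> real \<Rightarrow> (model \<Rightarrow> real \<Rightarrow> real) \<Rightarrow> bool" where
  "best_response p t V qstar \<longleftrightarrow>
     (\<forall>i. \<forall>s\<in>{0..1}. is_arg_max (user_utility p t V i s) (\<lambda>q. q \<in> {0..1}) (qstar i s))"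

lemma best_response_exists:
  assumes "0 < p M1" "p M1 < p M2" "p M2 < 1"
  shows "\<exists>qstar. best_response p t V qstar"
proof -
  have "\<exists>q. is_arg_max (user_utility p t V i s) (\<lambda>q. q \<in> {0..1}) q" if s: "s \<in> {0..1}" for i s
  proof -
    have beta_pos: "p M2 + (1 - p M2) * q \<noteq> 0" if "q \<in> {0..1}" for q
    proof -
      have "0 \<le> (1 - p M2) * q"
        using assms that by simp
      then show ?thesis
        using assms by linarith
    qed
    have denom: "alpha p q * (1 - s) \<noteq> 1" if q: "q \<in> {0..1}" for q
    proof -
      have "(1 - q) * (1 - s) \<le> 1"
        using q s by (intro mult_le_one) auto
      then have "(1 - p M1) * ((1 - q) * (1 - s)) \<le> (1 - p M1) * 1"
        using assms by (intro mult_left_mono) auto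
      also have "\<dots> < 1"
        using assms by simp
      finally show ?thesis
        unfolding alpha_def mult.assoc by (rule less_imp_neq)
    qed
    have alpha: "continuous_on {0..1} (alpha p)"
      unfolding alpha_def by (intro continuous_intros)
    have beta: "continuous_on {0..1} (beta p)"
      unfolding beta_def using beta_pos by (intro continuous_intros) auto
    have "continuous_on {0..1} (user_utility p t V i s)"
      unfolding user_utility_def
      by (cases i) (auto intro!: continuous_intros alpha beta simp: denom)
    then obtain q where "q \<in> {0..1}" "\<forall>y\<in>{0..1}. user_utility p t V i s y \<le> user_utility p t V i s q"
      using continuous_attains_sup[OF compact_Icc, of 0 1 "user_utility p t V i s"] by auto
    then show ?thesis
      by (auto simp: is_arg_max_linorder)
  qed
  then show ?thesis
    unfolding best_response_def
    by (intro exI[of _ "\<lambda>i s. SOME q. is_arg_max (user_utility p t V i s) (\<lambda>q. q \<in> {0..1}) q"] allI ballI)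
      (rule someI_ex)
qed

definition provider_optimal ::
  "(model \<Rightarrow> real) \<Rightarrow> (model \<Rightarrow> real) \<Rightarrow> real \<Rightarrow> (model \<Rightarrow> real \<Rightarrow> real) \<Rightarrow> model \<times> real \<Rightarrow> bool" where
  "provider_optimal p c P qstar =
     is_arg_min (\<lambda>(i, s). provider_cost p c P i s (qstar i s)) (\<lambda>(i, s). s \<in> {0..1})"

end

theory Submission
  imports Defs
begin

text \<open>
  User utility is the latency functional applied to the rewards \<open>xi\<close>, and that functional is linear
  in its rewards and, for positive rewards, strictly decreasing in the abandonment probability.
  Hence the user never abandons (\<open>q = 0\<close>) if both \<open>xi\<close> are positive and always abandons (\<open>q = 1\<close>)
  if both are negative. At \<open>q = 0\<close> every task succeeds in the end and the cost of \<open>(M1, s)\<close> is a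
  mediant of \<open>c M1 / p M1\<close> and \<open>c M2 / p M2\<close>; at \<open>q = 1\<close> only the initial model is
  tried, and only once.
\<close>

lemma user_utility_eq_latency: "user_utility p t V i s q = latency p (xi p t V) i s q"
  by (cases i) (simp_all add: user_utility_def xi_def diff_divide_distrib add_divide_distrib algebra_simps)

text \<open>Turns negative rewards into positive ones, so that one monotonicity lemma serves both
  signs of \<open>xi\<close>.\<close>

lemma latency_uminus: "latency p (\<lambda>j. - k j) i s q = - latency p k i s q"
  by (cases i) (simp_all add: minus_divide_left)

lemma provider_cost_abandonment: "provider_cost p c P i s 1 = c i + P * (1 - p i)"
  by (cases i) (simp_all add: provider_cost_def alpha_def beta_def)

context
  fixes p :: "model \<Rightarrow> real"
  assumes p1: "0 < p M1" and p12: "p M1 < p M2" and p2: "p M2 < 1"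
begin

lemma alpha_strict_antimono: "q < q' \<Longrightarrow> alpha p q' < alpha p q"
  using p12 p2 by (simp add: alpha_def)

lemma alpha_nonneg: "q \<le> 1 \<Longrightarrow> 0 \<le> alpha p q"
  using p12 p2 by (simp add: alpha_def)

lemma beta_pos: "0 \<le> q \<Longrightarrow> 0 < beta p q"
  using p1 p12 p2 by (simp add: beta_def add_pos_nonneg)

lemma beta_strict_antimono:
  assumes "0 \<le> q" "q < q'"
  shows "beta p q' < beta p q"
proof -
  have "(1 - p M2) * q < (1 - p M2) * q'"
    using assms p2 by simp
  moreover have "0 < p M2 + (1 - p M2) * q"
    using assms p1 p12 p2 by (simp add: add_pos_nonneg)
  ultimately show ?thesis
    unfolding beta_def by (intro divide_strict_left_mono mult_pos_pos) auto
qed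

text \<open>Keeps the denominator in the \<open>M1\<close> formulas positive. The extreme case is
  \<open>q = 0\<close>, \<open>s = 0\<close>, where the product is \<open>1 - p M1\<close>.\<close>

lemma continuation_less_1:
  assumes "s \<in> {0..1}" "0 \<le> q" "q \<le> 1"
  shows "alpha p q * (1 - s) < 1"
proof -
  have "alpha p q * (1 - s) \<le> alpha p q * 1"
    using assms alpha_nonneg by (intro mult_left_mono) auto
  also have "\<dots> \<le> alpha p 0"
    using alpha_strict_antimono[of 0 q] assms(2) by (cases "q = 0") auto
  also have "\<dots> < 1"
    using p1 by (simp add: alpha_def)
  finally show ?thesis .
qed

text \<open>Raising \<open>q\<close> lowers both \<open>alpha\<close> and \<open>beta\<close>, so
  for \<open>M1\<close> the numerator cannot grow and the denominator cannot shrink; for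
  \<open>M2\<close> only the factor \<open>beta\<close> varies.\<close>

lemma latency_strict_antimono:
  assumes k: "0 < k M1" "0 < k M2" and s: "s \<in> {0..1}" and q: "0 \<le> q" "q < q'" "q' \<le> 1"
  shows "latency p k i s q' < latency p k i s q"
proof (cases i)
  case M1
  let ?w = "\<lambda>q. alpha p q * beta p q"
  let ?num = "\<lambda>q. k M1 + ?w q * k M2 * s" and ?den = "\<lambda>q. 1 - alpha p q * (1 - s)"
  have w: "?w q' < ?w q" "0 \<le> ?w q'"
    using q alpha_strict_antimono[OF q(2)] beta_strict_antimono[OF q(1,2)]
      alpha_nonneg[of q'] beta_pos[of q'] by (auto intro!: mult_strict_mono)
  have num_pos: "0 < ?num q'"
    using k s by (intro add_pos_nonneg mult_nonneg_nonneg[OF mult_nonneg_nonneg[OF w(2)]]) auto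
  have den_pos: "0 < ?den q"
    using continuation_less_1[OF s] q by simp
  have num: "?num q' \<le> ?num q" and den: "?den q \<le> ?den q'"
    using w(1) alpha_strict_antimono[OF q(2)] k s by (simp_all add: mult_right_mono)
  have "?num q' / ?den q' < ?num q / ?den q"
  \<comment> \<open>Strictness has two sources: at \<open>s = 0\<close> the numerator is the
    constant \<open>k M1\<close> and the denominator grows strictly; for \<open>s > 0\<close> the
    numerator falls strictly, while the denominator is constant at \<open>s = 1\<close>.\<close>
  proof (cases "s = 0")
    case True
    then have "?den q < ?den q'"
      using alpha_strict_antimono[OF q(2)] by simp
    then show ?thesis
      using num_pos num den_pos by (intro frac_less2)
  next
    case False
    then have "?num q' < ?num q"
      using w k s by (auto intro!: mult_strict_right_mono)
    then show ?thesis
      using num_pos den den_pos by (intro frac_less) auto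
  qed
  then show ?thesis
    by (simp add: M1)
next
  case M2
  then show ?thesis
    using k beta_strict_antimono[OF q(1,2)] by simp
qed

lemma best_response_xi_pos:
  assumes "best_response p t V qstar" "0 < xi p t V M1" "0 < xi p t V M2" "s \<in> {0..1}"
  shows "qstar i s = 0"
proof (rule ccontr)
  assume "qstar i s \<noteq> 0"
  moreover have max: "is_arg_max (user_utility p t V i s) (\<lambda>q. q \<in> {0..1}) (qstar i s)"
    using assms unfolding best_response_def by blast
  ultimately have "user_utility p t V i s (qstar i s) < user_utility p t V i s 0"
    using assms unfolding user_utility_eq_latency is_arg_max_def
    by (intro latency_strict_antimono) auto
  with max show False
    by (auto simp: is_arg_max_def)
qed

lemma best_response_xi_neg:
  assumes "best_response p t V qstar" "xi p t V M1 < 0" "xi p t V M2 < 0" "s \<in> {0..1}"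
  shows "qstar i s = 1"
proof (rule ccontr)
  assume "qstar i s \<noteq> 1"
  moreover have max: "is_arg_max (user_utility p t V i s) (\<lambda>q. q \<in> {0..1}) (qstar i s)"
    using assms unfolding best_response_def by blast
  \<comment> \<open>The negated rewards are positive, so a best response below \<open>1\<close>
    could be improved by raising it to \<open>1\<close>.\<close>
  ultimately have "latency p (\<lambda>j. - xi p t V j) i s 1 < latency p (\<lambda>j. - xi p t V j) i s (qstar i s)"
    using assms unfolding is_arg_max_def by (intro latency_strict_antimono) auto
  then have "user_utility p t V i s (qstar i s) < user_utility p t V i s 1"
    by (simp only: user_utility_eq_latency latency_uminus)
  with max show False
    by (auto simp: is_arg_max_def)
qed

text \<open>At \<open>q = 0\<close> the numerator and denominator of the success probability
  coincide, so the penalty term vanishes.\<close>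

lemma provider_cost_M1_no_abandonment:
  assumes "s \<in> {0..1}"
  shows "provider_cost p c P M1 s 0
    = (c M1 + (1 - p M1) * s * (c M2 / p M2)) / (p M1 + (1 - p M1) * s)"
proof -
  have "0 < p M1 + (1 - p M1) * s"
    using assms p1 p12 p2 by (intro add_pos_nonneg) auto
  moreover have "1 - (1 - p M1) * (1 - s) = p M1 + (1 - p M1) * s"
    by (simp add: algebra_simps)
  ultimately show ?thesis
    using p1 p12 by (simp add: provider_cost_def alpha_def beta_def mult_ac)
qed

lemma provider_cost_M2_no_abandonment: "provider_cost p c P M2 s 0 = c M2 / p M2"
  using p1 p12 by (simp add: provider_cost_def beta_def)

text \<open>The cost of \<open>(M1, s)\<close> averages the two ratios with weights proportional to
  \<open>p M1\<close> and \<open>(1 - p M1) * s\<close>, so a common lower bound carries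
  over.\<close>

lemma provider_cost_no_abandonment_ge:
  assumes s: "s \<in> {0..1}" and m: "m \<le> c M1 / p M1" "m \<le> c M2 / p M2"
  shows "m \<le> provider_cost p c P i s 0"
proof (cases i)
  case M1
  have w: "0 \<le> (1 - p M1) * s"
    using s p12 p2 by simp
  then have "(1 - p M1) * s * m \<le> (1 - p M1) * s * (c M2 / p M2)"
    using m(2) by (rule mult_left_mono[rotated])
  moreover have "m * p M1 \<le> c M1"
    using m(1) p1 by (simp add: pos_le_divide_eq)
  ultimately show ?thesis
    using w p1 unfolding M1 provider_cost_M1_no_abandonment[OF s]
    by (simp add: pos_le_divide_eq add_pos_nonneg algebra_simps)
next
  case M2
  then show ?thesis
    using m provider_cost_M2_no_abandonment by simp
qed

end

lemma provider_optimalI: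
  assumes "s \<in> {0..1}"
    and "\<And>j r. r \<in> {0..1} \<Longrightarrow> provider_cost p c P i s (qstar i s) \<le> provider_cost p c P j r (qstar j r)"
  shows "provider_optimal p c P qstar (i, s)"
  using assms unfolding provider_optimal_def is_arg_min_linorder by auto

theorem theorem3:
  fixes p t c :: "model \<Rightarrow> real" and V P :: real
    and qstar :: "model \<Rightarrow> real \<Rightarrow> real"
  assumes "0 < p M1" and "p M1 < p M2" and "p M2 < 1"
    and "t M1 \<in> {0..1}" and "t M2 \<in> {0..1}" and "t M1 < t M2"
    and "c M1 \<in> {0..1}" and "c M2 \<in> {0..1}" and "c M1 < c M2"
    and "0 < V" and "0 < P"
    and "best_response p t V qstar"
  shows "(xi p t V M1 > 0 \<and> xi p t V M2 > 0 \<longrightarrow>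
            provider_optimal p c P qstar
              (if c M1 / p M1 \<le> c M2 / p M2 then (M1, 0) else (M2, 0)))
       \<and> (xi p t V M1 < 0 \<and> xi p t V M2 < 0 \<longrightarrow>
            (if P \<le> (c M2 - c M1) / (p M2 - p M1)
             then \<forall>s\<in>{0..1}. provider_optimal p c P qstar (M1, s)
             else provider_optimal p c P qstar (M2, 0)))"
proof -
  note p = \<open>0 < p M1\<close> \<open>p M1 < p M2\<close> \<open>p M2 < 1\<close>
  note br = \<open>best_response p t V qstar\<close>
  have "provider_optimal p c P qstar (if c M1 / p M1 \<le> c M2 / p M2 then (M1, 0) else (M2, 0))"
    if xi: "xi p t V M1 > 0" "xi p t V M2 > 0"
  proof -
    note q = best_response_xi_pos[OF p br xi]
    have M1: "provider_cost p c P M1 0 0 = c M1 / p M1"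
      using provider_cost_M1_no_abandonment[OF p, of 0] by simp
    have M2: "provider_cost p c P M2 0 0 = c M2 / p M2"
      by (rule provider_cost_M2_no_abandonment[OF p])
    \<comment> \<open>The claimed policy costs exactly the smaller ratio, which serves as the lower
      bound \<open>m\<close>.\<close>
    show ?thesis
      by (auto intro!: provider_optimalI provider_cost_no_abandonment_ge[OF p] simp: q M1 M2)
  qed
  moreover have "if P \<le> (c M2 - c M1) / (p M2 - p M1)
      then \<forall>s\<in>{0..1}. provider_optimal p c P qstar (M1, s)
      else provider_optimal p c P qstar (M2, 0)"
    if xi: "xi p t V M1 < 0" "xi p t V M2 < 0"
  proof -
    note q = best_response_xi_neg[OF p br xi]
    \<comment> \<open>At \<open>q = 1\<close> the cost does not depend on \<open>s\<close>, so only
      two numbers are compared and all policies starting with \<open>M1\<close> tie.\<close>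
    have opt: "provider_optimal p c P qstar (i, s)"
      if "s \<in> {0..1}" "\<And>j. c i + P * (1 - p i) \<le> c j + P * (1 - p j)" for i s
      using that by (intro provider_optimalI) (simp_all add: q provider_cost_abandonment)
    \<comment> \<open>The threshold for \<open>P\<close> is the comparison of these two costs,
      solved for \<open>P\<close> by dividing by \<open>p M2 - p M1 > 0\<close>.\<close>
    have iff: "P \<le> (c M2 - c M1) / (p M2 - p M1)
        \<longleftrightarrow> c M1 + P * (1 - p M1) \<le> c M2 + P * (1 - p M2)"
      using p(2) by (simp add: pos_le_divide_eq algebra_simps)
    show ?thesis
    proof (cases "c M1 + P * (1 - p M1) \<le> c M2 + P * (1 - p M2)")
      case True
      then have "c M1 + P * (1 - p M1) \<le> c j + P * (1 - p j)" for j
        by (cases j) auto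
      with True show ?thesis
        unfolding iff by (simp add: opt)
    next
      case False
      then have "c M2 + P * (1 - p M2) \<le> c j + P * (1 - p j)" for j
        by (cases j) auto
      with False show ?thesis
        unfolding iff by (simp add: opt)
    qed
  qed
  ultimately show ?thesis
    by blast
qed

end
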